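(* Let $f_1,\dots,f_M:\mathbb{R}^n\to\mathbb{R}^n$, let $\mathcal{S}$ be a finite (nonempty) set, let $\{V_\alpha\}_{\alpha\in\mathcal{S}}$ be a family of functions $V_\alpha:\mathbb{R}^n\to\mathbb{R}_{\ge0}$, and let $c:\mathbb{R}^n\to\mathbb{R}_{\ge0}$. Let $\mu\ge1$, let $s_{\gamma,\alpha,i,\vec\omega,\zeta}\ge0$ be real numbers indexed by $(\gamma,\alpha,i,\vec\omega,\zeta)\in\mathcal{S}\times\mathcal{S}\times\{1,\dots,M\}\times\mathcal{S}^M\times\mathcal{S}$, and let $t_{\gamma,\alpha,i,\vec\omega,j}\ge0$ be real numbers indexed by $(\gamma,\alpha,i,\vec\omega,j)\in\mathcal{S}\times\mathcal{S}\times\{1,\dots,M\}\times\mathcal{S}^M\times\{1,\dots,M\}$, such that $$V_\gamma(x)+\sum_{\zeta\in\mathcal{S}}s_{\gamma,\alpha,i,\vec\omega,\zeta}\bigl(V_\zeta(x)-V_\gamma(x)\bigr)\le\mu\,c(x)+V_\alpha(f_i(x))+\sum_{j=1}^M t_{\gamma,\alpha,i,\vec\omega,j}\bigl(V_{\vec\omega_j}(f_j(x))-V_\alpha(f_i(x))\bigr)$$ for all $x\in\mathbb{R}^n$ and all $(\gamma,\alpha,i,\vec\omega)\in\mathcal{S}\times\mathcal{S}\times\{1,\dots,M\}\times\mathcal{S}^M$. Then the function $V(x)=\min_{\alpha\in\mathcal{S}}V_\alpha(x)$ satisfies $$V(x)\le\mu\,c(x)+\max_{i\in\{1,\dots,M\}}V(f_i(x)),\qquad\forall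 x\in\mathbb{R}^n.$$
   Context: $M\ge1$ is an integer, and for $\vec\omega\in\mathcal{S}^M$, $\vec\omega_j\in\mathcal{S}$ denotes its $j$-th component. The maps $f_1,\dots,f_M$ are the modes of a switched system $x_{k+1}=f_{\sigma(k)}(x_k)$ with $\sigma:\mathbb{N}\to\{1,\dots,M\}$, and $c$ is its cost function. *)

theory Defs
  imports "HOL-Analysis.Analysis"
begin

end

theory Submission
  imports Defs
begin

text \<open>
  The hypothesis is an S-procedure certificate, and it only has to be read off at one well chosen
  index. Fix \<open>x\<close>. Let \<open>\<gamma>\<close> attain the minimum of \<open>V\<close> at \<open>x\<close>, let \<open>\<omega> j\<close> attain it at \<open>f j x\<close> for
  each mode \<open>j\<close>, let \<open>i\<close> be a mode with the largest of these successor minima, and put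
  \<open>\<alpha> = \<omega> i\<close>. Then \<open>V \<zeta> x - V \<gamma> x\<close> is nonnegative since \<open>\<gamma>\<close> is minimal at \<open>x\<close>, and
  \<open>V (\<omega> j) (f j x) - V \<alpha> (f i x)\<close> is nonpositive since \<open>i\<close> is the worst mode. As the multipliers
  are nonnegative, both sums can be dropped from the inequality without harming it, and what
  remains is the claim.
\<close>

theorem proposition6:
  fixes M :: nat
    and f :: "nat \<Rightarrow> real ^ 'n \<Rightarrow> real ^ 'n"
    and S :: "'s set"
    and V :: "'s \<Rightarrow> real ^ 'n \<Rightarrow> real"
    and c :: "real ^ 'n \<Rightarrow> real"
    and \<mu> :: real
    and s :: "'s \<Rightarrow> 's \<Rightarrow> nat \<Rightarrow> (nat \<Rightarrow> 's) \<Rightarrow> 's \<Rightarrow> real"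
    and t :: "'s \<Rightarrow> 's \<Rightarrow> nat \<Rightarrow> (nat \<Rightarrow> 's) \<Rightarrow> nat \<Rightarrow> real"
  assumes "M \<ge> 1"
    and "finite S" and "S \<noteq> {}"
    and "\<And>\<alpha> x. \<alpha> \<in> S \<Longrightarrow> V \<alpha> x \<ge> 0"
    and "\<And>x. c x \<ge> 0"
    and "\<mu> \<ge> 1"
    and "\<And>\<gamma> \<alpha> i \<omega> \<zeta>. \<lbrakk>\<gamma> \<in> S; \<alpha> \<in> S; i \<in> {1..M}; \<omega> \<in> {1..M} \<rightarrow>\<^sub>E S; \<zeta> \<in> S\<rbrakk>
           \<Longrightarrow> s \<gamma> \<alpha> i \<omega> \<zeta> \<ge> 0"
    and "\<And>\<gamma> \<alpha> i \<omega> j. \<lbrakk>\<gamma> \<in> S; \<alpha> \<in> S; i \<in> {1..M}; \<omega> \<in> {1..M} \<rightarrow>\<^sub>E S; j \<in> {1..M}\<rbrakk>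
           \<Longrightarrow> t \<gamma> \<alpha> i \<omega> j \<ge> 0"
    and "\<And>x \<gamma> \<alpha> i \<omega>. \<lbrakk>\<gamma> \<in> S; \<alpha> \<in> S; i \<in> {1..M}; \<omega> \<in> {1..M} \<rightarrow>\<^sub>E S\<rbrakk>
           \<Longrightarrow> V \<gamma> x + (\<Sum>\<zeta>\<in>S. s \<gamma> \<alpha> i \<omega> \<zeta> * (V \<zeta> x - V \<gamma> x))
               \<le> \<mu> * c x + V \<alpha> (f i x)
                 + (\<Sum>j=1..M. t \<gamma> \<alpha> i \<omega> j * (V (\<omega> j) (f j x) - V \<alpha> (f i x)))"
  shows "\<forall>x. (MIN \<alpha>\<in>S. V \<alpha> x) \<le> \<mu> * c x + (MAX i\<in>{1..M}. MIN \<alpha>\<in>S. V \<alpha> (f i x))"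
proof
  fix x
  define W where "W y = (MIN \<alpha>\<in>S. V \<alpha> y)" for y
  have W_le: "W y \<le> V \<zeta> y" if "\<zeta> \<in> S" for \<zeta> y
    unfolding W_def using that \<open>finite S\<close> by simp
  have "W y \<in> (\<lambda>\<alpha>. V \<alpha> y) ` S" for y
    unfolding W_def using \<open>finite S\<close> \<open>S \<noteq> {}\<close> by (intro Min_in) auto
  then have "\<forall>y. \<exists>\<alpha>\<in>S. V \<alpha> y = W y"
    by (metis imageE)
  then obtain m where m: "\<And>y. m y \<in> S" "\<And>y. V (m y) y = W y"
    by metis
  have modes: "finite ((\<lambda>i. W (f i x)) ` {1..M})" "(\<lambda>i. W (f i x)) ` {1..M} \<noteq> {}"
    using \<open>M \<ge> 1\<close> by auto
  obtain i where i: "i \<in> {1..M}" "W (f i x) = (MAX i\<in>{1..M}. W (f i x))"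
    using Max_in[OF modes] by auto
  have worst: "W (f j x) \<le> W (f i x)" if "j \<in> {1..M}" for j
    unfolding i(2) using that by simp
  define \<omega> where "\<omega> = (\<lambda>j\<in>{1..M}. m (f j x))"
  have \<omega>: "\<omega> \<in> {1..M} \<rightarrow>\<^sub>E S"
    unfolding \<omega>_def using m(1) by auto
  define \<gamma> \<alpha> where "\<gamma> = m x" and "\<alpha> = m (f i x)"
  have mem: "\<gamma> \<in> S" "\<alpha> \<in> S"
    unfolding \<gamma>_def \<alpha>_def using m(1) by auto
  have "(\<Sum>\<zeta>\<in>S. s \<gamma> \<alpha> i \<omega> \<zeta> * (V \<zeta> x - V \<gamma> x)) \<ge> 0"
    using assms(7)[OF mem i(1) \<omega>] W_le[of _ x] m(2)[of x]
    by (intro sum_nonneg mult_nonneg_nonneg) (auto simp: \<gamma>_def)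
  moreover have "(\<Sum>j=1..M. t \<gamma> \<alpha> i \<omega> j * (V (\<omega> j) (f j x) - V \<alpha> (f i x))) \<le> 0"
  proof (intro sum_nonpos mult_nonneg_nonpos)
    fix j assume j: "j \<in> {1..M}"
    show "t \<gamma> \<alpha> i \<omega> j \<ge> 0"
      using assms(8)[OF mem i(1) \<omega> j] .
    show "V (\<omega> j) (f j x) - V \<alpha> (f i x) \<le> 0"
      using worst[OF j] j m(2) by (simp add: \<omega>_def \<alpha>_def)
  qed
  ultimately have "V \<gamma> x \<le> \<mu> * c x + V \<alpha> (f i x)"
    using assms(9)[OF mem i(1) \<omega>, of x] by linarith
  then have "W x \<le> \<mu> * c x + (MAX i\<in>{1..M}. W (f i x))"
    using m(2) i(2) by (simp add: \<gamma>_def \<alpha>_def)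
  then show "(MIN \<alpha>\<in>S. V \<alpha> x) \<le> \<mu> * c x + (MAX i\<in>{1..M}. MIN \<alpha>\<in>S. V \<alpha> (f i x))"
    unfolding W_def .
qed

end
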